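(* Let $N$ be a positive integer. The function $f:=f_{N+2,N}(u)$ satisfies the inhomogeneous fourth-order linear differential equation (primes denote $\partial/\partial u$, and $f^{IV}$ the fourth derivative) $$\begin{aligned}&f^{IV}+2\,\frac{3u^3+2(N+1)u^2-u+(N+1)}{u^2(u^2-1)}f'''\\&+2\,\frac{3u^5+2(N+1)u^4-2(N+1)^2u^3+3(N+1)u^2+(6(N+1)^2-3)u -3(N+1)}{u^3(u^2-1)^2}f''\\&-2(N+1)\frac{4(N+1)u^2+8N(N+2)u -10(N+1)}{u^3(u^2-1)^2}f'\\&+\frac{4N(N+1)(N+2)(u+2(N+1))}{u^2(u^2-1)^2((N+1)u-1)}(f-1)=0\end{aligned}$$ (for all complex $u\notin\{0,1,-1,\frac1{N+1}\}$).
   Context: For nonnegative integers $A,B$ and complex $u\ne1$, $$f_{A,B}(u):=\frac1{2\pi i}\oint_{C_0}dz\,\Bigl(1+\frac1{u+z-1}\Bigr)^A\Bigl(1-\frac1z\Bigr)^B,$$ where $C_0$ is a small positively oriented contour encircling $z=0$ but not $z=1-u$ (i.e. $f_{A,B}(u)$ is the residue of the integrand at $z=0$; it is a rational function of $u$). *)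

theory Defs
  imports "HOL-Complex_Analysis.Complex_Analysis"
begin

definition f_AB :: "nat \<Rightarrow> nat \<Rightarrow> complex \<Rightarrow> complex" where
  "f_AB A B u = residue (\<lambda>z. (1 + 1 / (u + z - 1)) ^ A * (1 - 1 / z) ^ B) 0"

text \<open>For \<open>u \<noteq> 1\<close> the residue is the normalised contour integral over any circle around
  \<open>0\<close> that does not enclose \<open>1 - u\<close>.\<close>

lemma f_AB_contour_integral:
  assumes "0 < r" "r < cmod (1 - u)"
  shows "f_AB A B u = 1 / (2 * of_real pi * \<i>) *
           contour_integral (circlepath 0 r) (\<lambda>z. (1 + 1 / (u + z - 1)) ^ A * (1 - 1 / z) ^ B)"
proof -
  let ?S = "ball 0 (cmod (1 - u)) :: complex set"
  let ?g = "\<lambda>z. (1 + 1 / (u + z - 1)) ^ A * (1 - 1 / z) ^ B"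
  have nz: "u + z - 1 \<noteq> 0" if "z \<in> ?S" for z
  proof
    assume "u + z - 1 = 0"
    then have "z = 1 - u" by (simp add: algebra_simps)
    with that show False by simp
  qed
  have "?g holomorphic_on ?S - {0}"
    using nz by (intro holomorphic_intros) auto
  moreover have "cball 0 r \<subseteq> ?S" using assms by auto
  ultimately have "(?g has_contour_integral 2 * pi * \<i> * residue ?g 0) (circlepath 0 r)"
    using assms by (intro base_residue[of ?S]) auto
  then have "contour_integral (circlepath 0 r) ?g = 2 * pi * \<i> * residue ?g 0"
    by (rule contour_integral_unique)
  then show ?thesis by (simp add: f_AB_def)
qed

text \<open>Away from \<open>u = 1\<close> the function is holomorphic, so there all iterated applications of
  \<^const>\<open>deriv\<close> are genuine derivatives.\<close>

lemma f_AB_holomorphic: "f_AB A B holomorphic_on - {1}"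
proof (cases B)
  case 0
  have "f_AB A B u = 0" if "u \<noteq> 1" for u
  proof -
    have "(\<lambda>z. (1 + 1 / (u + z - 1)) ^ A) holomorphic_on - {1 - u}"
      by (intro holomorphic_intros) (auto simp: algebra_simps)
    then show ?thesis
      unfolding f_AB_def 0 power_0 mult_1_right using that by (intro residue_holo[of "- {1 - u}"]) auto
  qed
  then show ?thesis
    by (subst holomorphic_cong[OF refl, of _ _ "\<lambda>_. 0"]) auto
next
  case (Suc n)
  let ?h = "\<lambda>w::complex. (1 + 1 / (w - 1)) ^ A"
  let ?p = "\<lambda>z::complex. (z - 1) ^ B"
  have h: "?h holomorphic_on - {1}" by (intro holomorphic_intros) auto
  have eq: "f_AB A B u = (\<Sum>i = 0..n. of_nat (n choose i) * (deriv ^^ i) ?h u *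
              (deriv ^^ (n - i)) ?p 0) / fact n" if u: "u \<noteq> 1" for u
  proof -
    have shift: "(deriv ^^ i) (\<lambda>z. ?h (u + z)) 0 = (deriv ^^ i) ?h u" for i
      by (subst higher_deriv_shift_0[of i ?h u]) (simp add: o_def)
    have op: "open (- {1 - u})" "0 \<in> - {1 - u}" using u by auto
    have hu: "(\<lambda>z. ?h (u + z)) holomorphic_on - {1 - u}"
      by (intro holomorphic_intros) (auto simp: algebra_simps)
    have p: "?p holomorphic_on - {1 - u}" by (intro holomorphic_intros)
    have "f_AB A B u = residue (\<lambda>z. ?h (u + z) * ?p z / z ^ Suc n) 0"
      unfolding f_AB_def
    proof (rule residue_cong)
      show "\<forall>\<^sub>F z in at 0. (1 + 1 / (u + z - 1)) ^ A * (1 - 1 / z) ^ B = ?h (u + z) * ?p z / z ^ Suc n"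
        using eventually_at_ball'[of 1 "0::complex" UNIV, simplified]
      proof eventually_elim
        case (elim z)
        then have "1 - 1 / z = (z - 1) / z" by (simp add: field_simps)
        then show ?case by (simp only: Suc power_divide times_divide_eq_right)
      qed
    qed simp
    also have "\<dots> = (deriv ^^ n) (\<lambda>z. ?h (u + z) * ?p z) 0 / fact n"
      using op hu p by (intro residue_holomorphic_over_power'[of "- {1 - u}"] holomorphic_on_mult)
    also have "(deriv ^^ n) (\<lambda>z. ?h (u + z) * ?p z) 0 =
      (\<Sum>i = 0..n. of_nat (n choose i) * (deriv ^^ i) (\<lambda>z. ?h (u + z)) 0 * (deriv ^^ (n - i)) ?p 0)"
      by (rule higher_deriv_mult[OF hu p op])
    finally show ?thesis by (simp only: shift)
  qed
  have "(\<lambda>u. (\<Sum>i = 0..n. of_nat (n choose i) * (deriv ^^ i) ?h u *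
              (deriv ^^ (n - i)) ?p 0) / fact n) holomorphic_on - {1}"
    using h by (intro holomorphic_intros) auto
  then show ?thesis
    by (subst holomorphic_cong[OF refl eq]) auto
qed

end

theory Submission
  imports Defs
begin

text \<open>Put \<open>m = N + 1\<close>. Creative telescoping on the integrand gives a homogeneous third-order equation
  involving only \<open>f'\<close>, \<open>f''\<close> and \<open>f'''\<close>. It has a first integral \<open>f - \<alpha> f' - \<beta> f''\<close> with
  \<open>\<alpha>\<close>, \<open>\<beta>\<close> rational in \<open>u\<close>, whose value \<open>1\<close> is read off at \<open>u = 0\<close>, where
  \<open>f = N (N + 1) (N + 2) u^3 / 6 + O(u^4)\<close>. So \<open>f - 1\<close> already satisfies a homogeneous second-order
  equation, and the fourth-order equation is a combination of that equation, the third-order one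
  and the derivative of the latter.\<close>

section \<open>Residues of derivatives, and differentiation under the residue\<close>

text \<open>The integral of \<open>U'\<close> over a small circle vanishes because \<open>U\<close>
  is a single-valued primitive along it, and it is also a nonzero multiple of the residue. This
  disposes of the telescoped integrand in \<open>f_AB_third_order\<close>.\<close>

lemma residue_of_derivative:
  assumes "open S" "z0 \<in> S" "\<And>z. z \<in> S - {z0} \<Longrightarrow> (U has_field_derivative U' z) (at z)"
  shows "residue U' z0 = 0"
proof -
  obtain r where r: "r > 0" "cball z0 r \<subseteq> S"
    using assms open_contains_cball by blast
  have op: "open (S - {z0})" using assms(1) by auto
  have "U holomorphic_on S - {z0}"
    using assms(3) by (meson field_differentiable_at_within field_differentiable_def holomorphic_onI)
  then have "deriv U holomorphic_on S - {z0}"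
    using op by (rule holomorphic_deriv)
  then have "U' holomorphic_on S - {z0}"
    by (rule holomorphic_transform) (use assms(3) DERIV_imp_deriv in blast)
  then have "(U' has_contour_integral 2 * pi * \<i> * residue U' z0) (circlepath z0 r)"
    using assms r by (intro base_residue)
  moreover have "(U' has_contour_integral 0) (circlepath z0 r)"
    using assms(3) r by (intro Cauchy_theorem_primitive[of "S - {z0}" U])
      (auto intro: has_field_derivative_at_within)
  ultimately have "2 * pi * \<i> * residue U' z0 = 0"
    by (rule has_contour_integral_unique)
  then show ?thesis by simp
qed

text \<open>At a pole of order at most \<open>n + 1\<close> the residue is the Taylor coefficient of
  index \<open>n\<close> of the remaining factor, here expanded by the Leibniz rule. In the
  resulting finite sum \<open>u\<close> enters only through derivatives of \<open>h\<close> at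
  \<open>u\<close>.\<close>

lemma residue_translate_over_power:
  assumes "open S" "h holomorphic_on S" "open T" "0 \<in> T" "q holomorphic_on T" "u \<in> S"
  shows "residue (\<lambda>z. h (u + z) * (q z / z ^ Suc n)) 0 =
    (\<Sum>i = 0..n. of_nat (n choose i) * (deriv ^^ i) h u * (deriv ^^ (n - i)) q 0) / fact n"
proof -
  let ?S = "(\<lambda>z. u + z) -` S"
  have op: "open (?S \<inter> T)" "0 \<in> ?S \<inter> T"
    using assms by (auto intro!: open_vimage continuous_intros)
  have h: "(\<lambda>z. h (u + z)) holomorphic_on ?S \<inter> T"
    using assms(2) by (rule holomorphic_on_compose_gen[of "\<lambda>z. u + z" _ h S, unfolded o_def, rotated])
      (auto intro!: holomorphic_intros)
  have q: "q holomorphic_on ?S \<inter> T"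
    using assms by (auto intro: holomorphic_on_subset)
  have shift: "(deriv ^^ i) (\<lambda>z. h (u + z)) 0 = (deriv ^^ i) h u" for i
    by (subst higher_deriv_shift_0[of i h u]) (simp add: o_def)
  have "residue (\<lambda>z. h (u + z) * q z / z ^ Suc n) 0 = (deriv ^^ n) (\<lambda>z. h (u + z) * q z) 0 / fact n"
    using op h q by (intro residue_holomorphic_over_power'[of "?S \<inter> T"] holomorphic_on_mult)
  also have "(deriv ^^ n) (\<lambda>z. h (u + z) * q z) 0 =
      (\<Sum>i = 0..n. of_nat (n choose i) * (deriv ^^ i) (\<lambda>z. h (u + z)) 0 * (deriv ^^ (n - i)) q 0)"
    by (rule higher_deriv_mult[OF h q op])
  finally show ?thesis by (simp only: shift times_divide_eq_right)
qed

text \<open>Differentiation passes under the residue without exchanging a limit and an integral: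
  each step differentiates the finite Leibniz sum termwise and reads the outcome as a residue
  again.\<close>

lemma higher_deriv_residue_translate:
  assumes "open S" "h holomorphic_on S" "open T" "0 \<in> T" "q holomorphic_on T" "u \<in> S"
  shows "(deriv ^^ k) (\<lambda>u. residue (\<lambda>z. h (u + z) * (q z / z ^ Suc n)) 0) u =
    residue (\<lambda>z. (deriv ^^ k) h (u + z) * (q z / z ^ Suc n)) 0"
  using assms(6)
proof (induction k arbitrary: u)
  case (Suc k)
  let ?F = "\<lambda>g u. (\<Sum>i = 0..n. of_nat (n choose i) * (deriv ^^ i) g u * (deriv ^^ (n - i)) q 0) / fact n"
  have hol: "(deriv ^^ i) h holomorphic_on S" for i
    using assms by (intro holomorphic_higher_deriv)
  have step: "((deriv ^^ i) ((deriv ^^ k) h) has_field_derivative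
      (deriv ^^ i) ((deriv ^^ Suc k) h) u) (at u)" for i
    using holomorphic_derivI[OF hol[of "i + k"] assms(1) Suc.prems]
    by (simp add: funpow_add flip: funpow_Suc_right) (simp add: funpow_swap1)
  have "(?F ((deriv ^^ k) h) has_field_derivative ?F ((deriv ^^ Suc k) h) u) (at u)"
    by (auto intro!: derivative_eq_intros step simp: mult_ac)
  \<comment> \<open>The Leibniz sum represents the iterated derivative on all of the open set
    \<open>S\<close>, not just at \<open>u\<close>, so the derivative carries over.\<close>
  then have "((deriv ^^ k) (\<lambda>u. residue (\<lambda>z. h (u + z) * (q z / z ^ Suc n)) 0)
      has_field_derivative ?F ((deriv ^^ Suc k) h) u) (at u)"
    by (rule has_field_derivative_transform_within_open[OF _ assms(1) Suc.prems])
       (use Suc.IH hol residue_translate_over_power[OF assms(1) _ assms(3-5)] in auto)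
  then show ?case
    using residue_translate_over_power[OF assms(1) hol assms(3-5) Suc.prems, of "Suc k"]
    by (simp add: DERIV_imp_deriv)
qed auto

section \<open>Derivatives of the kernel \<open>(1 + 1 / (w - 1)) ^ A\<close>\<close>

text \<open>The logarithmic form keeps the full power as a factor and avoids the truncated exponent
  \<open>n - 1\<close>.\<close>

lemma has_field_derivative_power_log:
  fixes f :: "'a::real_normed_field \<Rightarrow> 'a"
  assumes "(f has_field_derivative f') (at x)" "f x \<noteq> 0"
  shows "((\<lambda>x. f x ^ n) has_field_derivative of_nat n * (f' / f x) * f x ^ n) (at x)"
proof (cases n)
  case (Suc k)
  then show ?thesis
    using DERIV_power[OF assms(1), of n] assms(2) by simp
qed auto

text \<open>The base equals \<open>w / (w - 1)\<close>, with logarithmic derivative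
  \<open>- 1 / (w * (w - 1))\<close>, so every derivative of \<open>h\<close> is a rational multiple
  of \<open>h\<close>. Each formula holds on an open set and can therefore be differentiated to
  obtain the next one.\<close>

lemma higher_deriv_power_kernel:
  fixes w :: complex and A :: nat
  assumes "w \<noteq> 0" "w \<noteq> 1"
  defines "h \<equiv> \<lambda>w::complex. (1 + 1 / (w - 1)) ^ A" and "a \<equiv> of_nat A"
  shows "(h has_field_derivative - a / (w * (w - 1)) * h w) (at w)"
    and "deriv h w = - a / (w * (w - 1)) * h w"
    and "(deriv ^^ 2) h w = a * (a + 2 * w - 1) / (w * (w - 1)) ^ 2 * h w"
    and "(deriv ^^ 3) h w = a * (2 * w * (w - 1) - (a + 2 * w - 1) * (a + 4 * w - 2))
           / (w * (w - 1)) ^ 3 * h w"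
proof -
  let ?S = "- {0, 1::complex}"
  have S: "open ?S" "w \<in> ?S" using assms by auto
  have 1: "(h has_field_derivative - a / (w * (w - 1)) * h w) (at w)" if "w \<in> ?S" for w
  proof -
    have nz: "w \<noteq> 0" "w - 1 \<noteq> 0" "1 + 1 / (w - 1) \<noteq> 0" using that by (auto simp: field_simps)
    have "((\<lambda>w. 1 + 1 / (w - 1)) has_field_derivative - 1 / (w - 1)\<^sup>2) (at w)"
      using nz by (auto intro!: derivative_eq_intros simp: power2_eq_square)
    from has_field_derivative_power_log[OF this nz(3), of A]
    have "(h has_field_derivative of_nat A * (- 1 / (w - 1)\<^sup>2 / (1 + 1 / (w - 1))) * h w) (at w)"
      unfolding h_def .
    moreover have "- 1 / (w - 1)\<^sup>2 / (1 + 1 / (w - 1)) = - 1 / (w * (w - 1))"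
      using nz by (simp add: divide_simps) (simp add: algebra_simps power2_eq_square)
    ultimately show ?thesis by (simp add: a_def)
  qed
  then have d1: "deriv h w = - a / (w * (w - 1)) * h w" if "w \<in> ?S" for w
    using that DERIV_imp_deriv by blast
  have 2: "(deriv h has_field_derivative a * (a + 2 * w - 1) / (w * (w - 1)) ^ 2 * h w) (at w)"
    if "w \<in> ?S" for w
  proof -
    have nz: "w \<noteq> 0" "w - 1 \<noteq> 0" using that by auto
    have "((\<lambda>w. - a / (w * (w - 1))) has_field_derivative
        a * (2 * w - 1) / (w * (w - 1)) ^ 2) (at w)"
      using nz by (auto intro!: derivative_eq_intros) (simp add: divide_simps, algebra)
    from DERIV_mult[OF this 1[OF that]]
    have "((\<lambda>w. - a / (w * (w - 1)) * h w) has_field_derivative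
        (a * (2 * w - 1) / (w * (w - 1)) ^ 2
          + - a / (w * (w - 1)) * (- a / (w * (w - 1)))) * h w) (at w)"
      by (simp add: algebra_simps)
    moreover have "a * (2 * w - 1) / (w * (w - 1)) ^ 2
          + - a / (w * (w - 1)) * (- a / (w * (w - 1)))
        = a * (a + 2 * w - 1) / (w * (w - 1)) ^ 2"
      using nz by (simp add: divide_simps) algebra
    ultimately have "((\<lambda>w. - a / (w * (w - 1)) * h w) has_field_derivative
        a * (a + 2 * w - 1) / (w * (w - 1)) ^ 2 * h w) (at w)"
      by simp
    then show ?thesis
      by (rule has_field_derivative_transform_within_open[of _ _ _ ?S]) (use that d1 S in auto)
  qed
  then have d2: "(deriv ^^ 2) h w = a * (a + 2 * w - 1) / (w * (w - 1)) ^ 2 * h w" if "w \<in> ?S" for w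
    using DERIV_imp_deriv[OF 2[OF that]] by (simp add: numeral_2_eq_2)
  have 3: "((deriv ^^ 2) h has_field_derivative
      a * (2 * w * (w - 1) - (a + 2 * w - 1) * (a + 4 * w - 2)) / (w * (w - 1)) ^ 3 * h w) (at w)"
    if "w \<in> ?S" for w
  proof -
    have nz: "w \<noteq> 0" "w - 1 \<noteq> 0" using that by auto
    have "((\<lambda>w. a * (a + 2 * w - 1) / (w * (w - 1)) ^ 2) has_field_derivative
        2 * a * (w * (w - 1) - (a + 2 * w - 1) * (2 * w - 1)) / (w * (w - 1)) ^ 3) (at w)"
      using nz by (auto intro!: derivative_eq_intros) (simp add: divide_simps, algebra)
    from DERIV_mult[OF this 1[OF that]]
    have "((\<lambda>w. a * (a + 2 * w - 1) / (w * (w - 1)) ^ 2 * h w) has_field_derivative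
        (2 * a * (w * (w - 1) - (a + 2 * w - 1) * (2 * w - 1)) / (w * (w - 1)) ^ 3
          + a * (a + 2 * w - 1) / (w * (w - 1)) ^ 2 * (- a / (w * (w - 1)))) * h w) (at w)"
      by (simp add: algebra_simps)
    moreover have "2 * a * (w * (w - 1) - (a + 2 * w - 1) * (2 * w - 1)) / (w * (w - 1)) ^ 3
          + a * (a + 2 * w - 1) / (w * (w - 1)) ^ 2 * (- a / (w * (w - 1)))
        = a * (2 * w * (w - 1) - (a + 2 * w - 1) * (a + 4 * w - 2)) / (w * (w - 1)) ^ 3"
      using nz by (simp add: divide_simps) algebra
    ultimately have "((\<lambda>w. a * (a + 2 * w - 1) / (w * (w - 1)) ^ 2 * h w) has_field_derivative
        a * (2 * w * (w - 1) - (a + 2 * w - 1) * (a + 4 * w - 2)) / (w * (w - 1)) ^ 3 * h w) (at w)"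
      by simp
    then show ?thesis
      by (rule has_field_derivative_transform_within_open[of _ _ _ ?S]) (use that d2 S in auto)
  qed
  show "(h has_field_derivative - a / (w * (w - 1)) * h w) (at w)"
    and "deriv h w = - a / (w * (w - 1)) * h w"
    and "(deriv ^^ 2) h w = a * (a + 2 * w - 1) / (w * (w - 1)) ^ 2 * h w"
    using S 1 d1 d2 by auto
  show "(deriv ^^ 3) h w = a * (2 * w * (w - 1) - (a + 2 * w - 1) * (a + 4 * w - 2))
           / (w * (w - 1)) ^ 3 * h w"
    using DERIV_imp_deriv[OF 3[OF S(2)]] by (simp add: numeral_3_eq_3 numeral_2_eq_2)
qed

section \<open>Derivatives of \<open>f_AB\<close> as residues, and the third-order equation\<close>

text \<open>Since \<open>1 - 1 / z = (z - 1) / z\<close>, the second factor is an entire function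
  over \<open>z ^ B\<close>, and \<open>B > 0\<close> allows \<open>B = Suc n\<close> as in the
  translation lemma.\<close>

lemma higher_deriv_f_AB:
  assumes "B > 0" "u \<noteq> 1"
  shows "(deriv ^^ k) (f_AB A B) u =
    residue (\<lambda>z. (deriv ^^ k) (\<lambda>w. (1 + 1 / (w - 1)) ^ A) (u + z) * (1 - 1 / z) ^ B) 0"
proof -
  let ?h = "\<lambda>w::complex. (1 + 1 / (w - 1)) ^ A" and ?q = "\<lambda>z::complex. (z - 1) ^ B"
  obtain n where n: "B = Suc n" using assms by (cases B) auto
  have eq: "residue (\<lambda>z. g (u + z) * (1 - 1 / z) ^ B) 0 =
      residue (\<lambda>z. g (u + z) * (?q z / z ^ Suc n)) 0" for g u
  proof (rule residue_cong)
    show "\<forall>\<^sub>F z in at 0. g (u + z) * (1 - 1 / z) ^ B = g (u + z) * (?q z / z ^ Suc n)"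
      using eventually_at_ball'[of 1 "0::complex" UNIV, simplified]
    proof eventually_elim
      case (elim z)
      then have "1 - 1 / z = (z - 1) / z" by (simp add: field_simps)
      then show ?case by (simp only: n power_divide)
    qed
  qed simp
  have "?h holomorphic_on - {1}" by (intro holomorphic_intros) auto
  moreover have "f_AB A B = (\<lambda>u. residue (\<lambda>z. ?h (u + z) * (?q z / z ^ Suc n)) 0)"
    unfolding f_AB_def using eq[of ?h] by fastforce
  ultimately show ?thesis
    unfolding eq using assms(2)
    by (simp only:) (intro higher_deriv_residue_translate[of "- {1}" _ UNIV];
      auto intro!: holomorphic_intros)
qed

text \<open>Telescoping certificate: the integrand is the \<open>z\<close>-derivative of the kernel times the rational
  function \<open>R\<close> below. The last summand of \<open>R\<close> was found by matching polar parts at \<open>z = 0\<close>,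
  \<open>z = - u\<close> and \<open>z = 1 - u\<close>; it depends on the two exponents differing by exactly \<open>2\<close>.\<close>

lemma f_AB_third_order:
  fixes N :: nat and u :: complex
  assumes "N > 0" "u \<noteq> 0" "u \<noteq> 1"
  defines "f \<equiv> f_AB (N + 2) N" and "m \<equiv> of_nat N + 1"
  shows "u ^ 2 * (u ^ 2 - 1) * (deriv ^^ 3) f u + u * (3 * u ^ 2 + 4 * m * u - 1) * (deriv ^^ 2) f u
    + (2 * m * u + 4) * deriv f u = 0"
proof -
  define h where "h = (\<lambda>w::complex. (1 + 1 / (w - 1)) ^ (N + 2))"
  define p where "p = (\<lambda>z::complex. (1 - 1 / z) ^ N)"
  define a :: complex where "a = of_nat (N + 2)"
  define b :: complex where "b = of_nat N"
  have ab: "a = b + 2" "m = b + 1" by (simp_all add: a_def b_def m_def)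
  define c3 where "c3 = u ^ 2 * (u ^ 2 - 1)"
  define c2 where "c2 = u * (3 * u ^ 2 + 4 * m * u - 1)"
  define c1 where "c1 = 2 * m * u + 4"
  define E1 where "E1 = (\<lambda>w. - a / (w * (w - 1)))"
  define E2 where "E2 = (\<lambda>w. a * (a + 2 * w - 1) / (w * (w - 1)) ^ 2)"
  define E3 where "E3 = (\<lambda>w. a * (2 * w * (w - 1) - (a + 2 * w - 1) * (a + 4 * w - 2)) / (w * (w - 1)) ^ 3)"
  \<comment> \<open>In \<open>z\<close> the \<open>c\<close>'s are constants, so
    \<open>c3 * h'' + c2 * h' + c1 * h\<close> at \<open>u + z\<close> is a primitive of the part of
    the integrand without \<open>p\<close>. Divided by \<open>h\<close>, it gives the first three
    summands of \<open>R\<close>; the summand with factor \<open>b\<close> compensates the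
    product-rule term containing the derivative of \<open>p\<close>.\<close>
  define R where "R = (\<lambda>z. c3 * E2 (u + z) + c2 * E1 (u + z) + c1
    - b * (u - 2 + a * u * (u - 1) / (u + z) - a * u * (u + 1) / (u + z - 1)))"
  \<comment> \<open>The removed points are those where \<open>h (u + z)\<close> or
    \<open>p z\<close> vanishes or \<open>h (u + z)\<close> is singular; \<open>u\<close> being
    neither \<open>0\<close> nor \<open>1\<close> keeps \<open>0\<close> inside
    \<open>S\<close>.\<close>
  define S where "S = - {1, - u, 1 - u}"
  let ?g = "\<lambda>k z. (deriv ^^ k) h (u + z) * p z"
  have S: "open S" "0 \<in> S" using assms by (auto simp: S_def)
  have "residue (\<lambda>z. c3 * ?g 3 z + c2 * ?g 2 z + c1 * ?g 1 z) 0 = 0"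
  proof (rule residue_of_derivative[OF S])
    fix z assume "z \<in> S - {0}"
    then have z: "z \<noteq> 0" "z - 1 \<noteq> 0" "u + z \<noteq> 0" "u + z - 1 \<noteq> 0" "u + z \<noteq> 1"
      by (auto simp: S_def add_eq_0_iff algebra_simps)
    have p: "(p has_field_derivative b / (z * (z - 1)) * p z) (at z)"
    proof -
      have "((\<lambda>z. 1 - 1 / z) has_field_derivative 1 / z ^ 2) (at z)"
        using z by (auto intro!: derivative_eq_intros simp: power2_eq_square)
      moreover have "1 - 1 / z \<noteq> 0" using z by (simp add: field_simps)
      ultimately have "(p has_field_derivative b * (1 / z ^ 2 / (1 - 1 / z)) * p z) (at z)"
        unfolding p_def b_def by (rule has_field_derivative_power_log)
      moreover have "1 / z ^ 2 / (1 - 1 / z) = 1 / (z * (z - 1))"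
        using z by (simp add: divide_simps) (simp add: algebra_simps power2_eq_square)
      ultimately show ?thesis by simp
    qed
    have h: "((\<lambda>z. h (u + z)) has_field_derivative E1 (u + z) * h (u + z)) (at z)"
    proof -
      have "(h has_field_derivative E1 (u + z) * h (u + z)) (at (u + z))"
        using higher_deriv_power_kernel(1)[OF z(3,5), of "N + 2"] by (simp only: h_def E1_def a_def)
      moreover have "((\<lambda>z. u + z) has_field_derivative 1) (at z)"
        by (auto intro!: derivative_eq_intros)
      ultimately show ?thesis
        using DERIV_chain2[where f = h and g = "\<lambda>z. u + z" and x = z] by fastforce
    qed
    define R' where "R' =
      c3 * (2 * a * ((u + z) * (u + z - 1) - (a + 2 * (u + z) - 1) * (2 * (u + z) - 1))
          / ((u + z) * (u + z - 1)) ^ 3)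
      + c2 * (a * (2 * (u + z) - 1) / ((u + z) * (u + z - 1)) ^ 2)
      + b * (a * u * (u - 1) / (u + z) ^ 2 - a * u * (u + 1) / (u + z - 1) ^ 2)"
    have R: "(R has_field_derivative R') (at z)"
    proof -
      have 1: "((\<lambda>z. E1 (u + z)) has_field_derivative
          a * (2 * (u + z) - 1) / ((u + z) * (u + z - 1)) ^ 2) (at z)"
        unfolding E1_def using z
        by (auto intro!: derivative_eq_intros) (simp add: divide_simps, algebra)
      have 2: "((\<lambda>z. E2 (u + z)) has_field_derivative
          2 * a * ((u + z) * (u + z - 1) - (a + 2 * (u + z) - 1) * (2 * (u + z) - 1))
            / ((u + z) * (u + z - 1)) ^ 3) (at z)"
        unfolding E2_def using z
        by (auto intro!: derivative_eq_intros) (simp add: divide_simps, algebra)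
      show ?thesis
        unfolding R_def R'_def using z
        by (auto intro!: derivative_eq_intros 1 2 simp: power2_eq_square) (simp add: algebra_simps)
    qed
    have hk: "deriv h (u + z) = E1 (u + z) * h (u + z)"
      "(deriv ^^ 2) h (u + z) = E2 (u + z) * h (u + z)"
      "(deriv ^^ 3) h (u + z) = E3 (u + z) * h (u + z)"
      using higher_deriv_power_kernel(2-4)[OF z(3,5), of "N + 2"]
      by (simp_all only: h_def E1_def E2_def E3_def a_def)
    \<comment> \<open>With \<open>h (u + z) * p z\<close> divided out, the telescoping is an
      identity between rational functions. Taking \<open>w = u + z\<close> and \<open>z\<close> as
      variables leaves only the denominators \<open>w\<close>, \<open>w - 1\<close>,
      \<open>z\<close> and \<open>z - 1\<close>.\<close>
    have cert: "R' + R z * (E1 (u + z) + b / (z * (z - 1)))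
      = c3 * E3 (u + z) + c2 * E2 (u + z) + c1 * E1 (u + z)"
    proof -
      obtain w where w: "w = u + z" by blast
      then have uw: "u = w - z" by simp
      have nz: "w \<noteq> 0" "w - 1 \<noteq> 0" "z \<noteq> 0" "z - 1 \<noteq> 0" using z w by auto
      show ?thesis
        unfolding R'_def R_def E1_def E2_def E3_def w[symmetric] c1_def c2_def c3_def ab uw
        using nz by (simp add: divide_simps) algebra
    qed
    have "((\<lambda>z. R z * (h (u + z) * p z)) has_field_derivative
      (R' + R z * (E1 (u + z) + b / (z * (z - 1)))) * (h (u + z) * p z)) (at z)"
      using DERIV_mult[OF R DERIV_mult[OF h p]] by (simp add: algebra_simps)
    then have "((\<lambda>z. R z * (h (u + z) * p z)) has_field_derivative
      (c3 * E3 (u + z) + c2 * E2 (u + z) + c1 * E1 (u + z)) * (h (u + z) * p z)) (at z)"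
      by (simp only: cert)
    then show "((\<lambda>z. R z * (h (u + z) * p z)) has_field_derivative
      c3 * ?g 3 z + c2 * ?g 2 z + c1 * ?g 1 z) (at z)"
      by (simp add: hk algebra_simps)
  qed
  moreover have hol: "?g k holomorphic_on S - {0}" for k
  proof -
    have "(deriv ^^ k) h holomorphic_on - {1}"
      unfolding h_def by (intro holomorphic_higher_deriv holomorphic_intros) auto
    then have "(\<lambda>z. (deriv ^^ k) h (u + z)) holomorphic_on S - {0}"
      by (rule holomorphic_on_compose_gen[of "\<lambda>z. u + z" _ _ "- {1}", unfolded o_def, rotated])
        (auto intro!: holomorphic_intros simp: S_def algebra_simps)
    then show ?thesis unfolding p_def by (intro holomorphic_intros) auto
  qed
  moreover have lin: "residue (\<lambda>z. x3 * g3 z + x2 * g2 z + x1 * g1 z) 0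
      = x3 * residue g3 0 + x2 * residue g2 0 + x1 * residue g1 0"
    if "g3 holomorphic_on S - {0}" "g2 holomorphic_on S - {0}" "g1 holomorphic_on S - {0}"
    for g1 g2 g3 :: "complex \<Rightarrow> complex" and x1 x2 x3
  proof -
    have "residue (\<lambda>z. x3 * g3 z + x2 * g2 z + x1 * g1 z) 0
        = residue (\<lambda>z. x3 * g3 z + x2 * g2 z) 0 + residue (\<lambda>z. x1 * g1 z) 0"
      by (intro residue_add[OF S] holomorphic_intros that)
    also have "residue (\<lambda>z. x3 * g3 z + x2 * g2 z) 0
        = residue (\<lambda>z. x3 * g3 z) 0 + residue (\<lambda>z. x2 * g2 z) 0"
      by (intro residue_add[OF S] holomorphic_intros that)
    finally show ?thesis
      by (simp only: residue_lmul[OF S that(1)] residue_lmul[OF S that(2)] residue_lmul[OF S that(3)])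
  qed
  ultimately have "c3 * residue (?g 3) 0 + c2 * residue (?g 2) 0 + c1 * residue (?g 1) 0 = 0"
    using lin[OF hol hol hol, of c3 3 c2 2 c1 1] by simp
  moreover have "residue (?g k) 0 = (deriv ^^ k) f u" for k
    using higher_deriv_f_AB[OF assms(1,3), of k "N + 2"] by (simp add: f_def h_def p_def)
  ultimately have "c3 * (deriv ^^ 3) f u + c2 * (deriv ^^ 2) f u + c1 * (deriv ^^ 1) f u = 0"
    by (simp only:)
  then show ?thesis by (simp add: c1_def c2_def c3_def)
qed

section \<open>Behaviour at \<open>u = 0\<close>, and the first integral\<close>

text \<open>At \<open>u = 0\<close> the two bases are reciprocal, so their powers leave just
  \<open>(z / (z - 1)) ^ 2\<close>. The \<open>k\<close>-th derivative contributes a pole of order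
  at most \<open>k\<close>, whence the integrand is regular at \<open>0\<close> for \<open>k\<close>
  up to \<open>2\<close> and has at most a simple pole for \<open>k = 3\<close>.\<close>

lemma f_AB_derivs_at_0:
  fixes N :: nat
  assumes "N > 0"
  defines "f \<equiv> f_AB (N + 2) N"
  shows "f 0 = 0" "deriv f 0 = 0" "(deriv ^^ 2) f 0 = 0"
    and "(deriv ^^ 3) f 0 = of_nat N * (of_nat N + 1) * (of_nat N + 2)"
proof -
  define h where "h = (\<lambda>w::complex. (1 + 1 / (w - 1)) ^ (N + 2))"
  define a :: complex where "a = of_nat (N + 2)"
  have res: "(deriv ^^ k) f 0 = residue (\<lambda>z. (deriv ^^ k) h z * (1 - 1 / z) ^ N) 0" for k
    using higher_deriv_f_AB[OF assms(1), of 0 k "N + 2"] by (simp add: f_def h_def)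
  have eq: "residue (\<lambda>z. (deriv ^^ k) h z * (1 - 1 / z) ^ N) 0 = residue (\<lambda>z. c z * (z / (z - 1)) ^ 2) 0"
    if c: "\<And>z. z \<noteq> 0 \<Longrightarrow> z \<noteq> 1 \<Longrightarrow> (deriv ^^ k) h z = c z * h z" for c :: "complex \<Rightarrow> complex" and k
  proof (rule residue_cong)
    show "\<forall>\<^sub>F z in at 0. (deriv ^^ k) h z * (1 - 1 / z) ^ N = c z * (z / (z - 1)) ^ 2"
      using eventually_at_ball'[of 1 "0::complex" UNIV, simplified]
    proof eventually_elim
      case (elim z)
      then have z: "z \<noteq> 0" "z \<noteq> 1" by auto
      then have "1 + 1 / (z - 1) = z / (z - 1)" "1 - 1 / z = (z - 1) / z" by (auto simp: field_simps)
      then have "h z * (1 - 1 / z) ^ N = (z / (z - 1)) ^ 2 * (z / (z - 1) * ((z - 1) / z)) ^ N"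
        by (simp only: h_def power_add power_mult_distrib) (simp add: mult_ac)
      then show ?case using c[OF z] z by (simp add: mult.assoc)
    qed
  qed simp
  have zero: "(deriv ^^ k) f 0 = 0"
    if c: "\<And>z. z \<noteq> 0 \<Longrightarrow> z \<noteq> 1 \<Longrightarrow> (deriv ^^ k) h z = c z * h z"
      and g: "\<And>z. z \<noteq> 0 \<Longrightarrow> z \<noteq> 1 \<Longrightarrow> c z * (z / (z - 1)) ^ 2 = g z" "g holomorphic_on - {1}"
    for c g :: "complex \<Rightarrow> complex" and k
  proof -
    have "residue (\<lambda>z. c z * (z / (z - 1)) ^ 2) 0 = residue g 0"
    proof (rule residue_cong)
      show "\<forall>\<^sub>F z in at 0. c z * (z / (z - 1)) ^ 2 = g z"
        using eventually_at_ball'[of 1 "0::complex" UNIV, simplified]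
      proof eventually_elim
        case (elim z)
        then have "z \<noteq> 1" by auto
        then show ?case using g(1) elim by blast
      qed
    qed simp
    also have "\<dots> = 0" using g(2) by (intro residue_holo[of "- {1}"]) auto
    finally show ?thesis using res[of k] eq[OF c] by simp
  qed
  have kernel: "deriv h z = - a / (z * (z - 1)) * h z"
    "(deriv ^^ 2) h z = a * (a + 2 * z - 1) / (z * (z - 1)) ^ 2 * h z"
    "(deriv ^^ 3) h z = a * (2 * z * (z - 1) - (a + 2 * z - 1) * (a + 4 * z - 2)) / (z * (z - 1)) ^ 3 * h z"
    if "z \<noteq> 0" "z \<noteq> 1" for z
    using higher_deriv_power_kernel(2-4)[OF that, of "N + 2"] by (simp_all only: h_def a_def)
  show "f 0 = 0"
  proof -
    have "(\<lambda>z. (z / (z - 1)) ^ 2) holomorphic_on - {1::complex}"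
      by (intro holomorphic_intros) auto
    then show ?thesis
      using zero[of 0 "\<lambda>_. 1" "\<lambda>z. (z / (z - 1)) ^ 2"] by simp
  qed
  show "deriv f 0 = 0"
  proof -
    have 1: "(deriv ^^ 1) h z = - a / (z * (z - 1)) * h z" if "z \<noteq> 0" "z \<noteq> 1" for z
      using kernel(1)[OF that] by (simp only: One_nat_def funpow.simps comp_id)
    have 2: "- a / (z * (z - 1)) * (z / (z - 1)) ^ 2 = - a * z / (z - 1) ^ 3"
      if "z \<noteq> 0" "z \<noteq> 1" for z
      using that by (simp add: divide_simps) (simp add: algebra_simps eval_nat_numeral)
    have "(\<lambda>z. - a * z / (z - 1) ^ 3) holomorphic_on - {1}" by (intro holomorphic_intros) auto
    from zero[OF 1 2 this] show ?thesis by simp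
  qed
  show "(deriv ^^ 2) f 0 = 0"
  proof -
    have "(\<lambda>z. a * (a + 2 * z - 1) / (z - 1) ^ 4) holomorphic_on - {1}"
      by (intro holomorphic_intros) auto
    moreover have "a * (a + 2 * z - 1) / (z * (z - 1)) ^ 2 * (z / (z - 1)) ^ 2
        = a * (a + 2 * z - 1) / (z - 1) ^ 4" if "z \<noteq> 0" "z \<noteq> 1" for z
    proof -
      have "K / (z * (z - 1)) ^ 2 * (z / (z - 1)) ^ 2 = K / (z - 1) ^ 4" for K
        using that by (simp add: divide_simps)
      then show ?thesis .
    qed
    ultimately show ?thesis
      using kernel(2) by (intro zero[of 2 "\<lambda>z. a * (a + 2 * z - 1) / (z * (z - 1)) ^ 2"
        "\<lambda>z. a * (a + 2 * z - 1) / (z - 1) ^ 4"])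
  qed
  define g where "g = (\<lambda>z. a * (2 * z * (z - 1) - (a + 2 * z - 1) * (a + 4 * z - 2)) / (z - 1) ^ 5)"
  have "(deriv ^^ 3) f 0 = residue (\<lambda>z. a * (2 * z * (z - 1) - (a + 2 * z - 1) * (a + 4 * z - 2))
      / (z * (z - 1)) ^ 3 * (z / (z - 1)) ^ 2) 0"
    unfolding res by (rule eq) (rule kernel(3))
  also have "\<dots> = residue (\<lambda>z. g z / (z - 0)) 0"
  proof (rule residue_cong)
    show "\<forall>\<^sub>F z in at 0. a * (2 * z * (z - 1) - (a + 2 * z - 1) * (a + 4 * z - 2))
      / (z * (z - 1)) ^ 3 * (z / (z - 1)) ^ 2 = g z / (z - 0)"
      using eventually_at_ball'[of 1 "0::complex" UNIV, simplified]
    proof eventually_elim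
      case (elim z)
      then have nz: "z \<noteq> 0" "z - 1 \<noteq> 0" by auto
      have "K / (z * (z - 1)) ^ 3 * (z / (z - 1)) ^ 2 = K / (z - 1) ^ 5 / (z - 0)" for K
        using nz by (simp add: divide_simps) (simp add: algebra_simps eval_nat_numeral)
      then show ?case unfolding g_def .
    qed
  qed simp
  \<comment> \<open>This value is \<open>a * (a - 1) * (a - 2)\<close> with
    \<open>a = N + 2\<close>.\<close>
  also have "\<dots> = g 0"
    by (rule residue_simple[of "- {1}"]) (auto simp: g_def intro!: holomorphic_intros)
  also have "\<dots> = of_nat N * (of_nat N + 1) * (of_nat N + 2)"
    by (simp add: g_def a_def algebra_simps)
  finally show "(deriv ^^ 3) f 0 = of_nat N * (of_nat N + 1) * (of_nat N + 2)" .
qed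

lemma f_AB_has_field_derivative:
  assumes "u \<noteq> 1"
  shows "((deriv ^^ k) (f_AB A B) has_field_derivative (deriv ^^ Suc k) (f_AB A B) u) (at u)"
proof -
  have "(deriv ^^ k) (f_AB A B) holomorphic_on - {1}"
    by (intro holomorphic_higher_deriv f_AB_holomorphic) auto
  from holomorphic_derivI[OF this, of u UNIV] show ?thesis using assms by auto
qed

text \<open>The claim is \<open>G u = 0\<close>. The third-order equation makes
  \<open>G u / u ^ 2\<close> locally constant; the plane without \<open>0\<close> and
  \<open>1\<close> is connected, and the limit at \<open>0\<close> shows that the constant is
  \<open>0\<close>.\<close>

lemma f_AB_second_order:
  fixes N :: nat and u :: complex
  assumes "N > 0" "u \<noteq> 0" "u \<noteq> 1"
  defines "f \<equiv> f_AB (N + 2) N" and "m \<equiv> of_nat N + 1"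
  shows "2 * m * (m ^ 2 - 1) * u ^ 2 * (f u - 1)
    = (m * u - 1) ^ 2 * (u ^ 2 - 1) * u * (deriv ^^ 2) f u
      + 2 * (m * u - 1) * ((2 * m ^ 2 - 1) * u ^ 2 - 2 * m * u + 1) * deriv f u"
proof -
  define c where "c = m * (m ^ 2 - 1)"
  define G where "G = (\<lambda>u. 2 * c * u ^ 2 * (f u - 1)
    - (m * u - 1) ^ 2 * (u ^ 2 - 1) * u * (deriv ^^ 2) f u
    - 2 * (m * u - 1) * ((2 * m ^ 2 - 1) * u ^ 2 - 2 * m * u + 1) * deriv f u)"
  define E where "E = (\<lambda>u. G u / u ^ 2)"
  have D: "(f has_field_derivative deriv f u) (at u)"
      "(deriv f has_field_derivative (deriv ^^ 2) f u) (at u)"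
      "((deriv ^^ 2) f has_field_derivative (deriv ^^ 3) f u) (at u)" if "u \<noteq> 1" for u
    using f_AB_has_field_derivative[OF that, of 0 "N + 2" N]
      f_AB_has_field_derivative[OF that, of 1 "N + 2" N]
      f_AB_has_field_derivative[OF that, of 2 "N + 2" N]
    by (simp_all add: f_def numeral_2_eq_2 numeral_3_eq_3)
  have ode: "u ^ 2 * (u ^ 2 - 1) * (deriv ^^ 3) f u + u * (3 * u ^ 2 + 4 * m * u - 1) * (deriv ^^ 2) f u
    + (2 * m * u + 4) * deriv f u = 0" if "u \<noteq> 0" "u \<noteq> 1" for u
    using f_AB_third_order[OF assms(1) that] by (simp add: f_def m_def)
  have dE: "(E has_field_derivative 0) (at u)" if "u \<noteq> 0" "u \<noteq> 1" for u
  proof -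
    define G' where "G' = 4 * c * u * (f u - 1) + 2 * c * u ^ 2 * deriv f u
      - (2 * m * (m * u - 1) * (u ^ 3 - u) + (m * u - 1) ^ 2 * (3 * u ^ 2 - 1)) * (deriv ^^ 2) f u
      - (m * u - 1) ^ 2 * (u ^ 2 - 1) * u * (deriv ^^ 3) f u
      - (2 * m * ((2 * m ^ 2 - 1) * u ^ 2 - 2 * m * u + 1)
          + 2 * (m * u - 1) * (2 * (2 * m ^ 2 - 1) * u - 2 * m)) * deriv f u
      - 2 * (m * u - 1) * ((2 * m ^ 2 - 1) * u ^ 2 - 2 * m * u + 1) * (deriv ^^ 2) f u"
    have "(G has_field_derivative G') (at u)"
      unfolding G_def G'_def
      by (auto intro!: derivative_eq_intros D[OF that(2)]) algebra
    \<comment> \<open>The difference \<open>u * G' - 2 * G u\<close> is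
      \<open>- (m * u - 1) ^ 2\<close> times the left-hand side of \<open>ode\<close>.\<close>
    moreover have "u * G' = 2 * G u"
      using ode[OF that] unfolding G'_def G_def c_def by algebra
    ultimately show ?thesis
      unfolding E_def using that
      by (auto intro!: derivative_eq_intros simp: power2_eq_square mult.commute)
  qed
  have ev: "\<forall>\<^sub>F u in at 0. u \<noteq> 0 \<and> u \<noteq> (1::complex)"
    using eventually_at_ball'[of 1 "0::complex" UNIV, simplified] by eventually_elim auto
  have lim: "(E \<longlongrightarrow> 0) (at 0)"
  proof -
    have m: "of_nat N * (of_nat N + 1) * (of_nat N + 2) = c"
      by (simp add: c_def m_def algebra_simps power2_eq_square)
    note v = f_AB_derivs_at_0[OF assms(1), folded f_def, unfolded m]
    have isC: "(f \<longlongrightarrow> 0) (at 0)" "((deriv ^^ 3) f \<longlongrightarrow> c) (at 0)"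
      using DERIV_isCont[OF D(1)[of 0]] DERIV_isCont[OF f_AB_has_field_derivative[of 0 3 "N + 2" N]] v
      by (simp_all add: isCont_def f_def)
    \<comment> \<open>As the first two derivatives vanish at \<open>0\<close>, this quotient and the
      next are difference quotients at \<open>0\<close>.\<close>
    have f2: "((\<lambda>u. (deriv ^^ 2) f u / u) \<longlongrightarrow> c) (at 0)"
      using D(3)[of 0] v by (simp add: has_field_derivative_iff)
    have f1: "((\<lambda>u. deriv f u / u) \<longlongrightarrow> 0) (at 0)"
      using D(2)[of 0] v by (simp add: has_field_derivative_iff)
    txt \<open>Divided by \<open>u^2\<close>, the third-order equation expresses \<open>f' / u^2\<close> through quotients whose
      limits at \<open>0\<close> are known.\<close>
    have "((\<lambda>u. (- (u ^ 2 - 1) * (deriv ^^ 3) f u - (3 * u ^ 2 + 4 * m * u - 1) * ((deriv ^^ 2) f u / u)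
       - 2 * m * (deriv f u / u)) / 4) \<longlongrightarrow>
       (- (0 ^ 2 - 1) * c - (3 * 0 ^ 2 + 4 * m * 0 - 1) * c - 2 * m * 0) / 4) (at 0)"
      by (intro tendsto_intros isC f1 f2) auto
    moreover have "\<forall>\<^sub>F u in at 0. (- (u ^ 2 - 1) * (deriv ^^ 3) f u - (3 * u ^ 2 + 4 * m * u - 1) * ((deriv ^^ 2) f u / u)
       - 2 * m * (deriv f u / u)) / 4 = deriv f u / u ^ 2"
      using ev
    proof eventually_elim
      case (elim u)
      then show ?case
        using ode[of u] by (simp add: divide_simps) algebra
    qed
    ultimately have "((\<lambda>u. deriv f u / u ^ 2) \<longlongrightarrow>
       (- (0 ^ 2 - 1) * c - (3 * 0 ^ 2 + 4 * m * 0 - 1) * c - 2 * m * 0) / 4) (at 0)"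
      by (rule Lim_transform_eventually)
    then have f1': "((\<lambda>u. deriv f u / u ^ 2) \<longlongrightarrow> c / 2) (at 0)"
      by simp
    \<comment> \<open>The three contributions to the limit are \<open>- 2 * c\<close>,
      \<open>c\<close> and \<open>c\<close>, which cancel.\<close>
    have "((\<lambda>u. 2 * c * (f u - 1) - (m * u - 1) ^ 2 * (u ^ 2 - 1) * ((deriv ^^ 2) f u / u)
      - 2 * (m * u - 1) * ((2 * m ^ 2 - 1) * u ^ 2 - 2 * m * u + 1) * (deriv f u / u ^ 2)) \<longlongrightarrow>
      2 * c * (0 - 1) - (m * 0 - 1) ^ 2 * (0 ^ 2 - 1) * c
      - 2 * (m * 0 - 1) * ((2 * m ^ 2 - 1) * 0 ^ 2 - 2 * m * 0 + 1) * (c / 2)) (at 0)"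
      by (intro tendsto_intros isC f1' f2)
    moreover have "\<forall>\<^sub>F u in at 0. 2 * c * (f u - 1) - (m * u - 1) ^ 2 * (u ^ 2 - 1) * ((deriv ^^ 2) f u / u)
      - 2 * (m * u - 1) * ((2 * m ^ 2 - 1) * u ^ 2 - 2 * m * u + 1) * (deriv f u / u ^ 2) = E u"
      using ev by eventually_elim (simp add: E_def G_def divide_simps, algebra)
    ultimately show ?thesis by (auto dest: tendsto_cong)
  qed
  have "connected (- {0, 1::complex})"
    using connected_open_delete_finite[of UNIV "{0, 1::complex}", OF open_UNIV connected_UNIV]
    by (simp add: Compl_eq_Diff_UNIV)
  then obtain k where k: "\<And>u. u \<in> - {0, 1} \<Longrightarrow> E u = k"
    by (rule DERIV_zero_connected_constant[of "- {0, 1}" "{}" E])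
      (auto intro!: continuous_at_imp_continuous_on dE DERIV_isCont)
  have "\<forall>\<^sub>F u in at 0. E u = k"
    using ev by eventually_elim (use k in auto)
  then have "k = 0"
    using lim tendsto_cong[of E "\<lambda>_. k"] by (simp add: tendsto_const_iff)
  then have "G u = 0"
    using k[of u] assms by (simp add: E_def)
  then show ?thesis by (simp add: G_def c_def algebra_simps)
qed

section \<open>Assembly of the fourth-order equation\<close>

theorem lemma4:
  fixes N :: nat and u :: complex
  assumes "N > 0"
    and "u \<notin> {0, 1, -1, 1 / (of_nat N + 1)}"
  shows "let f = f_AB (N + 2) N; n = (of_nat N :: complex) in
      (deriv ^^ 4) f u
      + 2 * ((3 * u ^ 3 + 2 * (n + 1) * u ^ 2 - u + (n + 1)) / (u ^ 2 * (u ^ 2 - 1)))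
          * (deriv ^^ 3) f u
      + 2 * ((3 * u ^ 5 + 2 * (n + 1) * u ^ 4 - 2 * (n + 1) ^ 2 * u ^ 3 + 3 * (n + 1) * u ^ 2
               + (6 * (n + 1) ^ 2 - 3) * u - 3 * (n + 1)) / (u ^ 3 * (u ^ 2 - 1) ^ 2))
          * (deriv ^^ 2) f u
      - 2 * (n + 1) * ((4 * (n + 1) * u ^ 2 + 8 * n * (n + 2) * u - 10 * (n + 1))
                        / (u ^ 3 * (u ^ 2 - 1) ^ 2))
          * deriv f u
      + (4 * n * (n + 1) * (n + 2) * (u + 2 * (n + 1)))
          / (u ^ 2 * (u ^ 2 - 1) ^ 2 * ((n + 1) * u - 1)) * (f u - 1) = 0"
proof -
  define f where "f = f_AB (N + 2) N"
  define n :: complex where "n = of_nat N"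
  define m where "m = n + 1"
  have mN: "m = of_nat N + 1" by (simp add: m_def n_def)
  have u: "u \<noteq> 0" "u \<noteq> 1" using assms by auto
  define T where "T = (\<lambda>u. u ^ 2 * (u ^ 2 - 1) * (deriv ^^ 3) f u
    + u * (3 * u ^ 2 + 4 * m * u - 1) * (deriv ^^ 2) f u + (2 * m * u + 4) * deriv f u)"
  define T' where "T' = u ^ 2 * (u ^ 2 - 1) * (deriv ^^ 4) f u
    + (4 * u ^ 3 - 2 * u + u * (3 * u ^ 2 + 4 * m * u - 1)) * (deriv ^^ 3) f u
    + (9 * u ^ 2 + 8 * m * u - 1 + (2 * m * u + 4)) * (deriv ^^ 2) f u + 2 * m * deriv f u"
  have T0: "T v = 0" if "v \<in> - {0, 1}" for v
    using f_AB_third_order[OF assms(1), of v] that by (simp add: T_def f_def mN)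
  have T'0: "T' = 0"
  proof -
    have "(T has_field_derivative T') (at u)"
      unfolding T_def T'_def
      using f_AB_has_field_derivative[OF u(2), of 1 "N + 2" N]
        f_AB_has_field_derivative[OF u(2), of 2 "N + 2" N]
        f_AB_has_field_derivative[OF u(2), of 3 "N + 2" N]
      by (auto intro!: derivative_eq_intros simp: f_def eval_nat_numeral) (simp add: algebra_simps)
    \<comment> \<open>\<open>T\<close> vanishes on a whole neighbourhood of \<open>u\<close>, hence
      so does its derivative at \<open>u\<close>.\<close>
    moreover have "(T has_field_derivative 0) (at u)"
      by (rule has_field_derivative_transform_within_open[of "\<lambda>_. 0" _ _ "- {0, 1}"])
        (use u T0 in auto)
    ultimately show ?thesis by (rule DERIV_unique)
  qed
  have nz: "u \<noteq> 0" "u ^ 2 - 1 \<noteq> 0" "m * u - 1 \<noteq> 0"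
  proof -
    show "u \<noteq> 0" by (fact u)
    have "u ^ 2 - 1 = (u - 1) * (u + 1)" by (simp add: algebra_simps power2_eq_square)
    then show "u ^ 2 - 1 \<noteq> 0" using assms by (auto simp: add_eq_0_iff2)
    have "m \<noteq> 0" unfolding mN using of_nat_neq_0 by (simp add: add.commute)
    then show "m * u - 1 \<noteq> 0" using assms by (auto simp: mN field_simps)
  qed
  note second = f_AB_second_order[OF assms(1) u, folded f_def mN]
  txt \<open>The coefficients come from right division of the fourth-order operator by the third-order one;
    the remainder of order two is a multiple of the second-order relation.\<close>
  define K where "K = u ^ 2 * (u ^ 2 - 1) * (m * u - 1) * T' + (m * u - 1) * (2 * m + u - u ^ 3) * T u
    + 2 * (u + 2 * m) * (2 * m * (m ^ 2 - 1) * u ^ 2 * (f u - 1)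
      - ((m * u - 1) ^ 2 * (u ^ 2 - 1) * u * (deriv ^^ 2) f u
      + 2 * (m * u - 1) * ((2 * m ^ 2 - 1) * u ^ 2 - 2 * m * u + 1) * deriv f u))"
  have "K = 0"
    unfolding K_def using T0[of u] T'0 second u by simp
  have n: "n = m - 1" by (simp add: m_def)
  \<comment> \<open>The denominator on the right is the coefficient of the fourth derivative in
    \<open>K\<close>, so dividing by it makes the equation monic. Its zeros are exactly the excluded
    values of \<open>u\<close>.\<close>
  have "(deriv ^^ 4) f u
      + 2 * ((3 * u ^ 3 + 2 * m * u ^ 2 - u + m) / (u ^ 2 * (u ^ 2 - 1))) * (deriv ^^ 3) f u
      + 2 * ((3 * u ^ 5 + 2 * m * u ^ 4 - 2 * m ^ 2 * u ^ 3 + 3 * m * u ^ 2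
               + (6 * m ^ 2 - 3) * u - 3 * m) / (u ^ 3 * (u ^ 2 - 1) ^ 2)) * (deriv ^^ 2) f u
      - 2 * m * ((4 * m * u ^ 2 + 8 * n * (n + 2) * u - 10 * m) / (u ^ 3 * (u ^ 2 - 1) ^ 2)) * deriv f u
      + (4 * n * m * (n + 2) * (u + 2 * m)) / (u ^ 2 * (u ^ 2 - 1) ^ 2 * (m * u - 1)) * (f u - 1)
    = K / (u ^ 4 * (u ^ 2 - 1) ^ 2 * (m * u - 1))"
    unfolding K_def T_def T'_def n using nz by (simp add: divide_simps) algebra
  with \<open>K = 0\<close> show ?thesis
    unfolding Let_def f_def[symmetric] n_def[symmetric] m_def[symmetric] by simp
qed

end
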